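(* Let $p\ge1$ and $L>0$. For every $t\ge0$ let $f_t:\mathbb R^p\to\mathbb R$ be $L$-smooth, let $x_t^*\in\mathbb R^p$ satisfy $\nabla f_t(x_t^* )=0$, and let $x_t\in\mathbb R^p$ and $\hat U_t\ge0$ satisfy $\|x_t-x_t^*\|^2\le\hat U_t$. Suppose there exist $0\le\gamma<1$ and $u_t\ge0$ such that, for all $t\ge0$, $$\sqrt{\hat U_{t+1}}\le\gamma\sqrt{\hat U_t}+u_t.$$ Then for every $T\ge0$, $$\sum_{t=0}^T\left(f_t(x_t)-f_t(x_t^* )\right)\le\frac{L}{(1-\gamma)^2}\hat U_0+\frac{L}{(1-\gamma)^2}\left(\sum_{t=0}^{T-1}u_t\right)^2.$$
   Context: A differentiable function $f$ is $L$-smooth if $\|\nabla f(x)-\nabla f(y)\|\le L\|x-y\|$ for all $x,y\in\mathbb R^p$. Empty sums are zero. *)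

theory Defs
  imports "HOL-Analysis.Analysis"
begin

definition gradient :: "('a::euclidean_space \<Rightarrow> real) \<Rightarrow> 'a \<Rightarrow> 'a" where
  "gradient f x = (THE d. GDERIV f x :> d)"

lemma gradient_eqI:
  assumes "GDERIV f x :> d"
  shows "gradient f x = d"
  unfolding gradient_def
proof (rule the_equality)
  fix e assume "GDERIV f x :> e"
  with assms have "(\<lambda>h. inner h e) = (\<lambda>h. inner h d)"
    unfolding gderiv_def by (metis has_derivative_unique)
  then show "e = d"
    by (metis vector_eq_rdot inner_commute)
qed (rule assms)

lemma GDERIV_gradient:
  assumes "f differentiable (at x)"
  shows "GDERIV f x :> gradient f x"
proof -
  obtain D where D: "(f has_derivative D) (at x)"
    using assms unfolding differentiable_def by blast
  then have lin: "linear D"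
    by (rule has_derivative_linear)
  have "D h = inner h (adjoint D 1)" for h
    using adjoint_works[OF lin, of h 1] by simp
  then have "D = (\<lambda>h. inner h (adjoint D 1))" by blast
  with D have "GDERIV f x :> adjoint D 1"
    unfolding gderiv_def by simp
  then show ?thesis
    using gradient_eqI by metis
qed

definition L_smooth :: "real \<Rightarrow> ('a::euclidean_space \<Rightarrow> real) \<Rightarrow> bool" where
  "L_smooth L f \<longleftrightarrow>
     (\<forall>x. f differentiable (at x)) \<and>
     (\<forall>x y. norm (gradient f x - gradient f y) \<le> L * norm (x - y))"

end

theory Submission
  imports Defs
begin

text \<open>
  By the descent lemma at a critical point, each summand is at most \<open>L / 2 * U t\<close>. With
  \<open>a t = sqrt (U t)\<close>, the sum of the \<open>U t\<close> is at most the square of the sum of the \<open>a t\<close>, and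
  summing the contraction bounds the latter sum by \<open>(a 0 + \<Sum>u) / (1 - \<gamma>)\<close>. The factor \<open>1 / 2\<close>
  is absorbed by \<open>(a + b)\<^sup>2 \<le> 2 * a\<^sup>2 + 2 * b\<^sup>2\<close>.
\<close>

text \<open>Along the segment from \<open>x\<close> to \<open>y\<close>, the Lipschitz bound on the
  gradient controls the slope of \<open>f\<close>, so subtracting the quadratic model leaves a
  function that cannot increase.\<close>

lemma L_smooth_descent:
  assumes "L_smooth L f"
  shows "f y \<le> f x + (y - x) \<bullet> gradient f x + L / 2 * (norm (y - x))\<^sup>2"
proof -
  define h where "h = y - x"
  \<comment> \<open>Here \<open>g 0 = f x\<close>, and \<open>g 1 \<le> g 0\<close> rearranges to
    the claim.\<close>
  define g where "g s = f (x + s *\<^sub>R h) - s * (h \<bullet> gradient f x) - L / 2 * s\<^sup>2 * (norm h)\<^sup>2" for s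
  have "\<exists>d. (g has_real_derivative d) (at s) \<and> d \<le> 0" if "0 \<le> s" for s
  proof -
    let ?z = "x + s *\<^sub>R h"
    have "(f has_derivative (\<lambda>k. k \<bullet> gradient f ?z)) (at ?z)"
      using assms GDERIV_gradient[of f ?z] unfolding L_smooth_def gderiv_def by blast
    moreover have "((\<lambda>r. x + r *\<^sub>R h) has_derivative (\<lambda>r. r *\<^sub>R h)) (at s)"
      by (auto intro!: derivative_eq_intros)
    ultimately have "((\<lambda>r. f (x + r *\<^sub>R h)) has_derivative (\<lambda>r. (r *\<^sub>R h) \<bullet> gradient f ?z)) (at s)"
      by (rule has_derivative_compose[rotated])
    then have "((\<lambda>r. f (x + r *\<^sub>R h)) has_real_derivative h \<bullet> gradient f ?z) (at s)"
      by (simp add: has_field_derivative_def mult.commute[of _ "h \<bullet> gradient f ?z"])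
    then have "(g has_real_derivative
        h \<bullet> gradient f ?z - h \<bullet> gradient f x - L * s * (norm h)\<^sup>2) (at s)"
      unfolding g_def by (auto intro!: derivative_eq_intros)
    moreover have "h \<bullet> gradient f ?z - h \<bullet> gradient f x \<le> L * s * (norm h)\<^sup>2"
    proof -
      have "h \<bullet> gradient f ?z - h \<bullet> gradient f x \<le> norm h * norm (gradient f ?z - gradient f x)"
        by (simp add: norm_cauchy_schwarz flip: inner_diff_right)
      also have "\<dots> \<le> norm h * (L * norm (?z - x))"
        using assms unfolding L_smooth_def by (intro mult_left_mono norm_ge_zero) blast
      \<comment> \<open>Since \<open>s\<close> is nonnegative, the norm of \<open>?z - x\<close> is
        \<open>s * norm h\<close>, without an absolute value.\<close>
      also have "\<dots> = L * s * (norm h)\<^sup>2"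
        using that by (simp add: power2_eq_square)
      finally show ?thesis .
    qed
    ultimately show ?thesis
      by (intro exI conjI) auto
  qed
  then have "g 1 \<le> g 0"
    by (intro DERIV_nonpos_imp_nonincreasing[of 0 1 g]) simp_all
  then show ?thesis
    by (simp add: g_def h_def)
qed

text \<open>Summing the recursion over \<open>t < T\<close> puts \<open>\<gamma>\<close> times the
  sum of \<open>a t\<close> over \<open>t < T\<close> on the right. Moving it to the left produces
  the factor \<open>1 - \<gamma>\<close> and leaves \<open>\<gamma> * a T\<close> over.\<close>

lemma sum_contraction_le:
  fixes a u :: "nat \<Rightarrow> real"
  assumes "0 \<le> \<gamma>" "\<gamma> < 1" "\<And>t. a t \<ge> 0" "\<And>t. a (Suc t) \<le> \<gamma> * a t + u t"
  shows "(\<Sum>t\<le>T. a t) \<le> (a 0 + (\<Sum>t<T. u t)) / (1 - \<gamma>)"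
proof -
  \<comment> \<open>The extra term \<open>\<gamma> * a T\<close> is the slack that makes the induction close.\<close>
  have "(1 - \<gamma>) * (\<Sum>t\<le>T. a t) + \<gamma> * a T \<le> a 0 + (\<Sum>t<T. u t)"
  proof (induction T)
    case 0
    then show ?case by (simp add: algebra_simps)
  next
    case (Suc T)
    then show ?case using assms(4)[of T] by (simp add: algebra_simps)
  qed
  moreover have "\<gamma> * a T \<ge> 0"
    using assms by simp
  ultimately have "(1 - \<gamma>) * (\<Sum>t\<le>T. a t) \<le> a 0 + (\<Sum>t<T. u t)"
    by linarith
  then show ?thesis
    using \<open>\<gamma> < 1\<close> by (simp add: pos_le_divide_eq mult.commute)
qed

text \<open>Expanding the square adds only nonnegative cross terms. For infinite \<open>A\<close>
  both sums are 0 by convention.\<close>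

lemma sum_power2_le_power2_sum:
  fixes a :: "'a \<Rightarrow> real"
  assumes "\<And>i. i \<in> A \<Longrightarrow> a i \<ge> 0"
  shows "(\<Sum>i\<in>A. (a i)\<^sup>2) \<le> (\<Sum>i\<in>A. a i)\<^sup>2"
  using assms
proof (induction A rule: infinite_finite_induct)
  case (insert i A)
  then have "a i * (\<Sum>i\<in>A. a i) \<ge> 0"
    by (simp add: sum_nonneg)
  with insert show ?case
    by (simp add: power2_sum)
qed auto

theorem lemma6p1:
  fixes L \<gamma> :: real
    and f :: "nat \<Rightarrow> real ^ 'p \<Rightarrow> real"
    and x xstar :: "nat \<Rightarrow> real ^ 'p"
    and U u :: "nat \<Rightarrow> real"
    and T :: nat
  assumes "L > 0"
    and "\<And>t. L_smooth L (f t)"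
    and "\<And>t. gradient (f t) (xstar t) = 0"
    and "\<And>t. U t \<ge> 0"
    and "\<And>t. (norm (x t - xstar t))\<^sup>2 \<le> U t"
    and "0 \<le> \<gamma>" and "\<gamma> < 1"
    and "\<And>t. u t \<ge> 0"
    and "\<And>t. sqrt (U (Suc t)) \<le> \<gamma> * sqrt (U t) + u t"
  shows "(\<Sum>t=0..T. f t (x t) - f t (xstar t))
      \<le> L / (1 - \<gamma>)\<^sup>2 * U 0 + L / (1 - \<gamma>)\<^sup>2 * (\<Sum>t<T. u t)\<^sup>2"
proof -
  define V where "V = (\<Sum>t<T. u t)"
  have summand: "f t (x t) - f t (xstar t) \<le> L / 2 * U t" for t
  proof -
    \<comment> \<open>With base point \<open>xstar t\<close> the linear term of the descent bound
      vanishes.\<close>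
    have "f t (x t) - f t (xstar t) \<le> L / 2 * (norm (x t - xstar t))\<^sup>2"
      using L_smooth_descent[OF assms(2), of t "x t" "xstar t"] assms(3)[of t] by simp
    also have "\<dots> \<le> L / 2 * U t"
      using assms(1) assms(5)[of t] by (intro mult_left_mono) auto
    finally show ?thesis .
  qed
  have "(\<Sum>t\<le>T. U t) \<le> (\<Sum>t\<le>T. sqrt (U t))\<^sup>2"
    using sum_power2_le_power2_sum[of "{..T}" "\<lambda>t. sqrt (U t)"] assms(4) by simp
  also have "\<dots> \<le> ((sqrt (U 0) + V) / (1 - \<gamma>))\<^sup>2"
  proof (rule power_mono)
    show "(\<Sum>t\<le>T. sqrt (U t)) \<le> (sqrt (U 0) + V) / (1 - \<gamma>)"
      unfolding V_def
      using sum_contraction_le[where a = "\<lambda>t. sqrt (U t)", OF assms(6,7) _ assms(9)] assms(4)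
      by simp
    show "0 \<le> (\<Sum>t\<le>T. sqrt (U t))"
      using assms(4) by (simp add: sum_nonneg)
  qed
  also have "\<dots> = (sqrt (U 0) + V)\<^sup>2 / (1 - \<gamma>)\<^sup>2"
    by (rule power_divide)
  \<comment> \<open>The cross term \<open>2 * sqrt (U 0) * V\<close> is at most
    \<open>U 0 + V\<^sup>2\<close>.\<close>
  also have "\<dots> \<le> (2 * U 0 + 2 * V\<^sup>2) / (1 - \<gamma>)\<^sup>2"
    using sum_squares_bound[of "sqrt (U 0)" V] assms(4)[of 0]
    by (intro divide_right_mono) (auto simp: power2_sum)
  finally have bound: "(\<Sum>t\<le>T. U t) \<le> (2 * U 0 + 2 * V\<^sup>2) / (1 - \<gamma>)\<^sup>2" .
  have "(\<Sum>t=0..T. f t (x t) - f t (xstar t)) \<le> L / 2 * (\<Sum>t\<le>T. U t)"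
    unfolding sum_distrib_left atLeast0AtMost by (intro sum_mono summand)
  also have "\<dots> \<le> L / 2 * ((2 * U 0 + 2 * V\<^sup>2) / (1 - \<gamma>)\<^sup>2)"
    using bound assms(1) by (intro mult_left_mono) auto
  also have "\<dots> = L / (1 - \<gamma>)\<^sup>2 * U 0 + L / (1 - \<gamma>)\<^sup>2 * V\<^sup>2"
    by (simp add: add_divide_distrib algebra_simps)
  finally show ?thesis
    unfolding V_def .
qed

end
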